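(* Let $\Sigma=\{\sigma_1,\ldots,\sigma_n\}$ be a semigroup of maps on $\{1,\ldots,N\}$, let $V$ be a finite dimensional real vector space, and let $A_{\sigma_j}:V^n\to V^n$ ($1\le j\le n$) be the linear maps $A_{\sigma_j}(X_1,\ldots,X_n)=(X_{\widetilde\sigma_1(j)},\ldots,X_{\widetilde\sigma_n(j)})$. Define, for smooth $f,g:V^n\to V$, the function $[f,g]_\Sigma:V^n\to V$ by $$[f,g]_\Sigma:=\sum_{j=1}^n D_jf\cdot(g\circ A_{\sigma_j})-D_jg\cdot(f\circ A_{\sigma_j}).$$ Then $[\gamma_f,\gamma_g]=\gamma_{[f,g]_\Sigma}$.
   Context: $N,n\ge 1$ are integers and $\Sigma=\{\sigma_1,\ldots,\sigma_n\}$ is a collection of $n$ distinct maps $\sigma_j:\{1,\ldots,N\}\to\{1,\ldots,N\}$. $\Sigma$ is called a semigroup if for all $1\le j_1,j_2\le n$ there is a unique $1\le j_3\le n$ with $\sigma_{j_1}\circ\sigma_{j_2}=\sigma_{j_3}$. In that case $\widetilde\sigma_j:\{1,\ldots,n\}\to\{1,\ldots,n\}$ is the map determined by $\sigma_{\widetilde\sigma_j(k)}=\sigma_j\circ\sigma_k$. For smooth $f:V^n\to V$ the coupled cell network vector field $\gamma_f:V^N\to V^N$ is defined by $(\gamma_f)_i(x)=f(x_{\sigma_1(i)},\ldots,x_{\sigma_n(i)})$ for $1\le i\le N$. $D_jf$ denotes the partial derivative of $f$ with respect to its $j$-th argument $X_j\in V$ (a linear map $V\to V$ at each point). The Lie bracket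 of vector fields on $V^N$ is taken with the convention $[F,G](x)=DF(x)\cdot G(x)-DG(x)\cdot F(x)$. *)

theory Defs
  imports "HOL-Analysis.Analysis"
begin

text \<open>
  The index sets \<open>{1, ..., N}\<close> and \<open>{1, ..., n}\<close> are arbitrary finite (hence nonempty) types
  \<open>'N\<close> and \<open>'n\<close>, so that \<open>V\<^sup>N\<close> and \<open>V\<^sup>n\<close> are \<open>'v ^ 'N\<close> and \<open>'v ^ 'n\<close>. A collection of \<open>n\<close>
  distinct maps on \<open>{1, ..., N}\<close> is an injective family \<open>\<sigma> :: 'n \<Rightarrow> 'N \<Rightarrow> 'N\<close>.
\<close>

definition is_semigroup :: "('n \<Rightarrow> 'N \<Rightarrow> 'N) \<Rightarrow> bool" where
  "is_semigroup \<sigma> \<longleftrightarrow> (\<forall>j1 j2. \<exists>!j3. \<sigma> j1 \<circ> \<sigma> j2 = \<sigma> j3)"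

definition sigma_tilde :: "('n \<Rightarrow> 'N \<Rightarrow> 'N) \<Rightarrow> 'n \<Rightarrow> 'n \<Rightarrow> 'n" where
  "sigma_tilde \<sigma> j k = (THE l. \<sigma> l = \<sigma> j \<circ> \<sigma> k)"

definition A_map :: "('n::finite \<Rightarrow> 'N \<Rightarrow> 'N) \<Rightarrow> 'n \<Rightarrow> 'v ^ 'n \<Rightarrow> 'v ^ 'n" where
  "A_map \<sigma> j X = (\<chi> i. X $ sigma_tilde \<sigma> i j)"

definition network_vf ::
    "('n::finite \<Rightarrow> 'N::finite \<Rightarrow> 'N) \<Rightarrow> ('v ^ 'n \<Rightarrow> 'v) \<Rightarrow> 'v ^ 'N \<Rightarrow> 'v ^ 'N" where
  "network_vf \<sigma> f x = (\<chi> i. f (\<chi> j. x $ \<sigma> j i))"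

text \<open>
  On a finite-dimensional domain (the only use below) \<open>times_cont_differentiable k f\<close> is the
  usual notion of a \<open>C\<^sup>k\<close> map: all iterated directional derivatives up to order \<open>k\<close> exist and
  are continuous.
\<close>

primrec times_cont_differentiable ::
    "nat \<Rightarrow> ('a::real_normed_vector \<Rightarrow> 'b::real_normed_vector) \<Rightarrow> bool" where
  "times_cont_differentiable 0 f \<longleftrightarrow> continuous_on UNIV f"
| "times_cont_differentiable (Suc k) f \<longleftrightarrow>
     (\<forall>x. f differentiable (at x)) \<and>
     (\<forall>v. times_cont_differentiable k (\<lambda>x. frechet_derivative f (at x) v))"

definition smooth :: "('a::real_normed_vector \<Rightarrow> 'b::real_normed_vector) \<Rightarrow> bool" where
  "smooth f \<longleftrightarrow> (\<forall>k. times_cont_differentiable k f)"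

definition partial_deriv ::
    "'n::finite \<Rightarrow> ('v::real_normed_vector ^ 'n \<Rightarrow> 'v) \<Rightarrow> 'v ^ 'n \<Rightarrow> 'v \<Rightarrow> 'v" where
  "partial_deriv j f X =
     frechet_derivative (\<lambda>Y. f (\<chi> i. if i = j then Y else X $ i)) (at (X $ j))"

text \<open>The sign convention is \<open>[F, G] = DF \<cdot> G - DG \<cdot> F\<close>.\<close>

definition lie_bracket ::
    "('a::real_normed_vector \<Rightarrow> 'a) \<Rightarrow> ('a \<Rightarrow> 'a) \<Rightarrow> 'a \<Rightarrow> 'a" where
  "lie_bracket F G x = frechet_derivative F (at x) (G x) - frechet_derivative G (at x) (F x)"

definition sigma_bracket ::
    "('n::finite \<Rightarrow> 'N \<Rightarrow> 'N) \<Rightarrow> ('v::real_normed_vector ^ 'n \<Rightarrow> 'v) \<Rightarrow> ('v ^ 'n \<Rightarrow> 'v)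
      \<Rightarrow> 'v ^ 'n \<Rightarrow> 'v" where
  "sigma_bracket \<sigma> f g X =
     (\<Sum>j\<in>UNIV. partial_deriv j f X (g (A_map \<sigma> j X)) - partial_deriv j g X (f (A_map \<sigma> j X)))"

end

theory Submission
  imports Defs
begin

text \<open>
  Fix a cell \<open>i\<close> and write \<open>X = (x $ \<sigma> j i)\<^sub>j\<close> for the vector of inputs that it receives, a
  linear function of \<open>x\<close>, so that the \<open>i\<close>-th component of \<open>network_vf \<sigma> f\<close> at \<open>x\<close> is \<open>f X\<close>.
  The chain rule and the expansion of a total derivative into partial derivatives give, for the
  \<open>i\<close>-th component of the derivative of \<open>network_vf \<sigma> f\<close> in the direction \<open>network_vf \<sigma> g x\<close>,
  the sum over \<open>j\<close> of \<open>partial_deriv j f X\<close> applied to \<open>g\<close> evaluated at the inputs of the cell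
  \<open>\<sigma> j i\<close>.

  The semigroup property enters at this point: the cell \<open>\<sigma> j i\<close> receives
  \<open>x $ \<sigma> k (\<sigma> j i) = x $ \<sigma> (sigma_tilde \<sigma> k j) i = X $ sigma_tilde \<sigma> k j\<close> as its \<open>k\<close>-th input,
  so its inputs are \<open>A_map \<sigma> j X\<close>, a function of the inputs of \<open>i\<close> alone
  (\<open>inputs_of_input_cell\<close>). Subtracting the same expression with \<open>f\<close> and \<open>g\<close>
  exchanged gives the Lie bracket on one side and \<open>sigma_bracket \<sigma> f g X\<close> on the other.
\<close>

lemma bounded_linear_axis: "bounded_linear (axis k :: 'v::real_normed_vector \<Rightarrow> 'v ^ 'n::finite)"
proof (rule bounded_linear_intro[where K = 1])
  show "norm (axis k x :: 'v ^ 'n) \<le> norm x * 1" for x :: 'v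
  proof -
    have "norm (axis k x :: 'v ^ 'n) \<le> (\<Sum>i\<in>UNIV. norm ((axis k x :: 'v ^ 'n) $ i))"
      by (simp add: norm_vec_def L2_set_le_sum)
    also have "\<dots> = norm x"
      by (simp add: axis_def if_distrib[of norm] cong: if_cong)
    finally show ?thesis by simp
  qed
qed (simp_all add: axis_def vec_eq_iff)

text \<open>
  Writing a vector as a sum over its axes reduces componentwise differentiation to the rules for
  sums and bounded linear maps, and linearity turns the same decomposition into the expansion of
  a derivative into partial derivatives.
\<close>

lemma vec_lambda_eq_sum_axis:
  fixes c :: "'n::finite \<Rightarrow> 'v::real_normed_vector"
  shows "(\<chi> i. c i) = (\<Sum>k\<in>UNIV. axis k (c k))"
  by (simp add: vec_eq_iff axis_def)

lemma has_derivative_vec_lambda: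
  fixes F :: "'n::finite \<Rightarrow> 'a::real_normed_vector \<Rightarrow> 'v::real_normed_vector"
  assumes "\<And>i. (F i has_derivative F' i) net"
  shows "((\<lambda>x. \<chi> i. F i x) has_derivative (\<lambda>h. \<chi> i. F' i h)) net"
  unfolding vec_lambda_eq_sum_axis
  by (intro has_derivative_sum bounded_linear.has_derivative[OF bounded_linear_axis] assms)

text \<open>
  The chain rule for the affine map that inserts \<open>Y\<close> in the \<open>j\<close>-th place of \<open>X\<close>; its derivative
  is \<open>axis j\<close>.
\<close>

lemma partial_deriv_eq_derivative_axis:
  fixes f :: "'v::real_normed_vector ^ 'n::finite \<Rightarrow> 'v"
  assumes f: "(f has_derivative f') (at X)"
  shows "partial_deriv j f X h = f' (axis j h)"
proof -
  let ?insert = "\<lambda>Y. \<chi> i. if i = j then Y else X $ i"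
  have "(?insert has_derivative (\<lambda>h. \<chi> i. if i = j then h else 0)) (at (X $ j))"
  proof (rule has_derivative_vec_lambda)
    show "((\<lambda>Y. if i = j then Y else X $ i) has_derivative (\<lambda>h. if i = j then h else 0))
            (at (X $ j))" for i
      by (cases "i = j") simp_all
  qed
  moreover have "?insert (X $ j) = X"
    by (simp add: vec_eq_iff)
  then have "(f has_derivative f') (at (?insert (X $ j)))"
    using f by (simp only:)
  ultimately have "((\<lambda>Y. f (?insert Y)) has_derivative
      (\<lambda>h. f' (\<chi> i. if i = j then h else 0))) (at (X $ j))"
    by (rule has_derivative_compose)
  from frechet_derivative_at[OF this] show ?thesis
    by (simp add: partial_deriv_def axis_def fun_eq_iff)
qed

lemma derivative_eq_sum_partial_deriv:
  fixes f :: "'v::real_normed_vector ^ 'n::finite \<Rightarrow> 'v"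
  assumes f: "(f has_derivative f') (at X)"
  shows "f' h = (\<Sum>j\<in>UNIV. partial_deriv j f X (h $ j))"
proof -
  have "f' h = f' (\<Sum>j\<in>UNIV. axis j (h $ j))"
    by (simp flip: vec_lambda_eq_sum_axis)
  also have "\<dots> = (\<Sum>j\<in>UNIV. f' (axis j (h $ j)))"
    by (rule linear_sum[OF has_derivative_linear[OF f]])
  finally show ?thesis
    by (simp add: partial_deriv_eq_derivative_axis[OF f])
qed

lemma derivative_network_vf:
  fixes \<sigma> :: "'n::finite \<Rightarrow> 'N::finite \<Rightarrow> 'N"
    and f :: "'v::real_normed_vector ^ 'n \<Rightarrow> 'v"
  assumes f: "\<And>X. f differentiable (at X)"
  shows "frechet_derivative (network_vf \<sigma> f) (at x) h $ i =
           (\<Sum>j\<in>UNIV. partial_deriv j f (\<chi> j. x $ \<sigma> j i) (h $ \<sigma> j i))"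
proof -
  let ?inputs = "\<lambda>i (y :: 'v ^ 'N). (\<chi> j. y $ \<sigma> j i) :: 'v ^ 'n"
  let ?Df = "\<lambda>X. frechet_derivative f (at X)"
  have Df: "(f has_derivative ?Df X) (at X)" for X
    using f frechet_derivative_works by blast
  have "(?inputs i has_derivative ?inputs i) (at x)" for i
    by (intro has_derivative_vec_lambda bounded_linear_imp_has_derivative bounded_linear_vec_nth)
  then have "((\<lambda>y. f (?inputs i y)) has_derivative (\<lambda>h. ?Df (?inputs i x) (?inputs i h))) (at x)"
    for i using Df by (rule has_derivative_compose)
  then have "(network_vf \<sigma> f has_derivative (\<lambda>h. \<chi> i. ?Df (?inputs i x) (?inputs i h))) (at x)"
    unfolding network_vf_def[abs_def] by (rule has_derivative_vec_lambda)
  then have "frechet_derivative (network_vf \<sigma> f) (at x) =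
      (\<lambda>h. \<chi> i. ?Df (?inputs i x) (?inputs i h))"
    by (rule frechet_derivative_at[symmetric])
  then show ?thesis
    by (simp add: derivative_eq_sum_partial_deriv[OF Df])
qed

lemma sigma_sigma_tilde:
  assumes "is_semigroup \<sigma>"
  shows "\<sigma> (sigma_tilde \<sigma> j k) = \<sigma> j \<circ> \<sigma> k"
proof -
  have "\<exists>!l. \<sigma> l = \<sigma> j \<circ> \<sigma> k"
    using assms unfolding is_semigroup_def by metis
  then show ?thesis
    unfolding sigma_tilde_def by (rule theI')
qed

text \<open>
  Closure under composition makes the inputs of the cell \<open>\<sigma> j i\<close> a selection, possibly with
  repetitions, of the inputs of \<open>i\<close>, and the selection \<open>A_map \<sigma> j\<close> is the same for all \<open>i\<close>.
  This is why the bracket of two network vector fields again has the form \<open>network_vf \<sigma> _\<close>.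
\<close>

lemma inputs_of_input_cell:
  assumes "is_semigroup \<sigma>"
  shows "(\<chi> k. x $ \<sigma> k (\<sigma> j i)) = A_map \<sigma> j (\<chi> k. x $ \<sigma> k i)"
  by (simp add: A_map_def vec_eq_iff sigma_sigma_tilde[OF assms])

lemma derivative_network_vf_along_network_vf:
  fixes \<sigma> :: "'n::finite \<Rightarrow> 'N::finite \<Rightarrow> 'N"
    and f g :: "'v::real_normed_vector ^ 'n \<Rightarrow> 'v"
  assumes "is_semigroup \<sigma>" and "\<And>X. f differentiable (at X)"
  shows "frechet_derivative (network_vf \<sigma> f) (at x) (network_vf \<sigma> g x) $ i =
           (\<Sum>j\<in>UNIV. partial_deriv j f (\<chi> j. x $ \<sigma> j i) (g (A_map \<sigma> j (\<chi> j. x $ \<sigma> j i))))"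
  by (simp add: derivative_network_vf[OF assms(2)] network_vf_def[of \<sigma> g]
      inputs_of_input_cell[OF assms(1)])

lemma smooth_imp_differentiable: "smooth f \<Longrightarrow> f differentiable (at x)"
  unfolding smooth_def by (drule spec[where x = "Suc 0"]) simp

theorem theorem5p1:
  fixes \<sigma> :: "'n::finite \<Rightarrow> 'N::finite \<Rightarrow> 'N"
    and f g :: "'v::real_normed_vector ^ 'n \<Rightarrow> 'v"
  assumes finite_dim: "\<exists>B :: 'v set. finite B \<and> span B = UNIV"
    and distinct: "inj \<sigma>"
    and semigroup: "is_semigroup \<sigma>"
    and smooth_f: "smooth f"
    and smooth_g: "smooth g"
  shows "lie_bracket (network_vf \<sigma> f) (network_vf \<sigma> g) = network_vf \<sigma> (sigma_bracket \<sigma> f g)"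
proof (rule ext)
  fix x :: "'v ^ 'N"
  show "lie_bracket (network_vf \<sigma> f) (network_vf \<sigma> g) x = network_vf \<sigma> (sigma_bracket \<sigma> f g) x"
    by (simp add: vec_eq_iff lie_bracket_def sigma_bracket_def sum_subtractf
        network_vf_def[of \<sigma> "sigma_bracket \<sigma> f g"]
        derivative_network_vf_along_network_vf[OF semigroup smooth_imp_differentiable[OF smooth_f]]
        derivative_network_vf_along_network_vf[OF semigroup smooth_imp_differentiable[OF smooth_g]])
qed

end
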